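(* Let $R$ be a p.q.-Baer $*$-ring and $a,b\in R$. Then the following statements are equivalent: (1) $a^*rb=a^*ra$ for all $r\in R$; (2) $a=C(a)b$; (3) $arb=ara$ for all $r\in R$ (that is, $a\leq b$ in Conrad's partial order).
   Context: A $*$-ring is an (associative) ring $R$ with an involution $x\mapsto x^*$, i.e. an additive anti-automorphism with $(x^* )^*=x$. A projection is an element $e\in R$ with $e=e^2=e^*$. A $*$-ring $R$ is a p.q.-Baer $*$-ring if for every $a\in R$ there is a projection $e\in R$ with $r_R(aR)=eR$, where $r_R(B)=\{x\in R : bx=0 \text{ for every } b\in B\}$. (Such a ring automatically has an identity element and is semiprime.) The central cover $C(x)$ of $x\in R$ is the smallest central projection $h$ with $hx=x$ (central projections being ordered by $e\leq f \iff e=ef$); it is known that every element of a p.q.-Baer $*$-ring has a central cover. *)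

theory Defs
  imports Main
begin

text \<open>Rings are associative and not assumed to have an identity element, matching the class
  \<^class>\<open>ring\<close>. That a p.q.-Baer *-ring has one follows from its axiom applied to 0.\<close>

class star_ring = ring +
  fixes star :: "'a \<Rightarrow> 'a"
  assumes star_add: "star (x + y) = star x + star y"
    and star_mult: "star (x * y) = star y * star x"
    and star_star: "star (star x) = x"
begin

definition projection :: "'a \<Rightarrow> bool" where
  "projection e \<longleftrightarrow> e = e * e \<and> e = star e"

definition right_mults :: "'a \<Rightarrow> 'a set" where
  "right_mults a = {a * r | r. True}"

definition right_annihilator :: "'a set \<Rightarrow> 'a set" where
  "right_annihilator B = {x. \<forall>b\<in>B. b * x = 0}"

definition central_projection :: "'a \<Rightarrow> bool" where
  "central_projection e \<longleftrightarrow> projection e \<and> (\<forall>x. e * x = x * e)"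

definition proj_le :: "'a \<Rightarrow> 'a \<Rightarrow> bool" where
  "proj_le e f \<longleftrightarrow> e = e * f"

definition is_central_cover :: "'a \<Rightarrow> 'a \<Rightarrow> bool" where
  "is_central_cover x h \<longleftrightarrow>
     central_projection h \<and> h * x = x \<and>
     (\<forall>k. central_projection k \<and> k * x = x \<longrightarrow> proj_le h k)"

text \<open>Two central covers of the same element coincide, since \<^const>\<open>proj_le\<close> is antisymmetric on
  central projections. In a p.q.-Baer *-ring every element has one, so the description below is
  then proper.\<close>

definition central_cover :: "'a \<Rightarrow> 'a" where
  "central_cover x = (THE h. is_central_cover x h)"

end

class pq_baer_star_ring = star_ring +
  assumes pq_baer: "\<exists>e. projection e \<and> right_annihilator (right_mults a) = right_mults e"

end

theory Submission imports Defs begin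

text \<open>The annihilator of \<open>a R\<close> is an ideal \<open>e R\<close>, so \<open>e\<close> is central and \<open>1 - e\<close> is the central
  cover of \<open>a\<close>; thus \<open>a R x = 0\<close> exactly when \<open>C(a) x = 0\<close>. Since \<open>C(a\<^sup>*) = C(a)\<close>, the conditions
  \<open>a R (b - a) = 0\<close> and \<open>a\<^sup>* R (b - a) = 0\<close> both say \<open>C(a) b = C(a) a = a\<close>.\<close>

lemma central_projectionD:
  assumes "central_projection e"
  shows "e * e = e" "star e = e" "e * x = x * e"
  using assms unfolding central_projection_def projection_def by metis+

lemma star_zero: "star (0::'a::star_ring) = 0"
  using star_add[of 0 "0::'a"] by simp

lemma star_minus: "star (- x) = - star (x::'a::star_ring)"
  using star_add[of x "- x"] by (simp add: star_zero eq_neg_iff_add_eq_0 add.commute[of "star (- x)"])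

lemma star_diff: "star (x - y) = star x - star (y::'a::star_ring)"
  using star_add[of x "- y"] by (simp add: star_minus)

text \<open>As \<open>e\<close> is idempotent, membership in \<open>right_mults e\<close> amounts to
  being fixed by left multiplication by \<open>e\<close>. This turns the axiom into an equation that
  needs no set notation.\<close>

lemma pq_baer_annihilator:
  fixes a :: "'a::pq_baer_star_ring"
  obtains e where "projection e" "\<And>x. (\<forall>r. a * r * x = 0) \<longleftrightarrow> e * x = x"
proof -
  obtain e where e: "projection e" "right_annihilator (right_mults a) = right_mults e"
    using pq_baer by blast
  have "x \<in> right_mults e \<longleftrightarrow> e * x = x" for x
  proof
    assume "x \<in> right_mults e"
    then obtain r where "x = e * r"
      by (auto simp: right_mults_def)
    moreover have "e * e = e"
      using e(1) by (simp add: projection_def)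
    ultimately show "e * x = x"
      by (simp flip: mult.assoc)
  next
    assume "e * x = x"
    then have "x = e * x" ..
    then show "x \<in> right_mults e"
      unfolding right_mults_def by blast
  qed
  moreover have "x \<in> right_annihilator (right_mults a) \<longleftrightarrow> (\<forall>r. a * r * x = 0)" for x
    by (auto simp: right_annihilator_def right_mults_def)
  ultimately show thesis
    using that e by metis
qed

text \<open>Every element is annihilated by \<open>0\<close>, so the projection belonging to
  \<open>0\<close> is a left identity; the involution makes it a right identity as well.\<close>

lemma pq_baer_identity:
  obtains u :: "'a::pq_baer_star_ring" where "\<And>x. u * x = x" "\<And>x. x * u = x" "star u = u"
proof -
  obtain u :: 'a where u: "projection u" "\<And>x. u * x = x"
    using pq_baer_annihilator[of 0] by (metis mult_zero_left)
  have s: "star u = u"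
    using u(1) by (simp add: projection_def)
  have "x * u = x" for x
    using u(2)[of "star x"] s star_mult[of u "star x"] by (simp add: star_star)
  with u s that show thesis
    by blast
qed

lemma pq_baer_central_annihilator:
  fixes a :: "'a::pq_baer_star_ring"
  obtains e where "central_projection e" "\<And>x. (\<forall>r. a * r * x = 0) \<longleftrightarrow> e * x = x"
proof -
  obtain e where e: "projection e" and ann: "\<And>x. (\<forall>r. a * r * x = 0) \<longleftrightarrow> e * x = x"
    using pq_baer_annihilator[of a] by blast
  have ee: "e * e = e" and es: "star e = e"
    using e by (simp_all add: projection_def)
  have ann_e: "a * r * e = 0" for r
    using ann ee by blast
  \<comment> \<open>The annihilator is also closed under left multiplication, so it contains
    \<open>s * e\<close>, which \<open>e\<close> must then fix.\<close>
  have "a * r * (s * e) = 0" for r s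
    using ann_e[of "r * s"] by (simp add: mult.assoc)
  then have ese: "e * (s * e) = s * e" for s
    using ann by blast
  have "e * s = s * e" for s
  proof -
    \<comment> \<open>Taking adjoints of \<open>ese\<close> at \<open>star s\<close> gives
      \<open>e * s * e = e * s\<close>; together with \<open>ese\<close> at \<open>s\<close> this
      yields \<open>e * s = s * e\<close>.\<close>
    have "star (e * (star s * e)) = star (star s * e)"
      using ese by simp
    then show ?thesis
      using ese[of s] by (simp add: star_mult star_star es mult.assoc)
  qed
  then have "central_projection e"
    using e by (simp add: central_projection_def)
  with ann that show thesis
    by blast
qed

lemma is_central_cover_unique:
  assumes "is_central_cover x h" "is_central_cover x k"
  shows "h = k"
proof -
  have hk: "h = h * k" and kh: "k = k * h" and h: "central_projection h"
    using assms unfolding is_central_cover_def proj_le_def by blast+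
  have "h = k * h"
    using hk central_projectionD(3)[OF h, of k] by (rule trans)
  also have "\<dots> = k"
    using kh by (rule sym)
  finally show ?thesis .
qed

lemma central_cover_eqI: "is_central_cover x h \<Longrightarrow> central_cover x = h"
  unfolding central_cover_def by (rule the_equality) (assumption, rule is_central_cover_unique)

text \<open>Both claims are read off from the explicit cover \<open>u - e\<close>, where
  \<open>u\<close> is the identity and \<open>e\<close> the central projection for the
  annihilator.\<close>

lemma pq_baer_central_cover:
  fixes a :: "'a::pq_baer_star_ring"
  shows is_central_cover_central_cover: "is_central_cover a (central_cover a)"
    and central_cover_annihilator: "(\<forall>r. a * r * x = 0) \<longleftrightarrow> central_cover a * x = 0"
proof -
  obtain u :: 'a where u: "\<And>x. u * x = x" "\<And>x. x * u = x" "star u = u"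
    using pq_baer_identity by blast
  obtain e where e: "central_projection e" and ann: "\<And>x. (\<forall>r. a * r * x = 0) \<longleftrightarrow> e * x = x"
    using pq_baer_central_annihilator[of a] by blast
  note eD = central_projectionD[OF e]
  have "central_projection (u - e)"
    unfolding central_projection_def projection_def
  proof (intro conjI allI)
    show "u - e = (u - e) * (u - e)"
      by (simp add: left_diff_distrib right_diff_distrib u eD(1))
    show "u - e = star (u - e)"
      by (simp add: star_diff u eD(2))
    show "(u - e) * x = x * (u - e)" for x
      by (simp only: left_diff_distrib right_diff_distrib u eD(3)[of x])
  qed
  moreover have "(u - e) * a = a"
  proof -
    \<comment> \<open>\<open>e\<close> lies in the annihilator because it fixes itself; the choice
      \<open>r = u\<close> gives \<open>a * e = 0\<close>.\<close>
    have "a * u * e = 0"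
      using ann eD(1) by blast
    then show ?thesis
      by (simp add: eD(3)[of a] u left_diff_distrib)
  qed
  moreover have "proj_le (u - e) k" if k: "central_projection k" "k * a = a" for k
  proof -
    \<comment> \<open>Minimality: \<open>u - k\<close> lies in the annihilator, and
      \<open>e * (u - k) = u - k\<close> rearranges to \<open>u - e = (u - e) * k\<close>.\<close>
    have "a * r * (u - k) = 0" for r
    proof -
      have "a * r * k = a * r"
        using central_projectionD(3)[OF k(1), of "a * r"] k(2) by (metis mult.assoc)
      then show ?thesis
        by (simp add: right_diff_distrib u)
    qed
    then have "e * (u - k) = u - k"
      using ann by blast
    then show ?thesis
      by (simp add: proj_le_def algebra_simps u)
  qed
  ultimately have cover: "is_central_cover a (u - e)"
    by (simp add: is_central_cover_def)
  then have eq: "central_cover a = u - e"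
    by (rule central_cover_eqI)
  show "is_central_cover a (central_cover a)"
    using cover eq by simp
  show "(\<forall>r. a * r * x = 0) \<longleftrightarrow> central_cover a * x = 0"
    unfolding ann eq left_diff_distrib u right_minus_eq by (rule eq_commute)
qed

lemma central_projection_mult_star:
  assumes "central_projection k"
  shows "k * star x = star x \<longleftrightarrow> k * x = x"
proof -
  have "star (k * x) = k * star x" for x
    by (simp only: star_mult central_projectionD(2)[OF assms] central_projectionD(3)[OF assms, of "star x"])
  then show ?thesis
    by (metis star_star)
qed

text \<open>The same central projections fix \<open>a\<close> and \<open>star a\<close>, so both
  covers are described by the same predicate.\<close>

lemma central_cover_star: "central_cover (star a) = central_cover a"
proof -
  have "is_central_cover (star a) h = is_central_cover a h" for h
    unfolding is_central_cover_def using central_projection_mult_star by blast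
  then show ?thesis
    by (simp add: central_cover_def)
qed

text \<open>The cover fixes \<open>a\<close>, so it sends \<open>b - a\<close> to
  \<open>central_cover a * b - a\<close>.\<close>

lemma eq_central_cover_mult_iff:
  fixes a b :: "'a::pq_baer_star_ring"
  shows "a = central_cover a * b \<longleftrightarrow> (\<forall>r. a * r * (b - a) = 0)"
proof -
  have "central_cover a * a = a"
    using is_central_cover_central_cover[of a] by (simp add: is_central_cover_def)
  then show ?thesis
    unfolding central_cover_annihilator by (auto simp: right_diff_distrib)
qed

theorem lemma2p4:
  fixes a b :: "'a::pq_baer_star_ring"
  shows "((\<forall>r. star a * r * b = star a * r * a) \<longleftrightarrow> a = central_cover a * b) \<and>
         (a = central_cover a * b \<longleftrightarrow> (\<forall>r. a * r * b = a * r * a))"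
proof -
  \<comment> \<open>Used with both \<open>c = a\<close> and \<open>c = star a\<close>.\<close>
  have "(\<forall>r. c * r * b = c * r * a) \<longleftrightarrow> (\<forall>r. c * r * (b - a) = 0)" for c
    by (simp add: right_diff_distrib)
  moreover have "(\<forall>r. star a * r * (b - a) = 0) \<longleftrightarrow> (\<forall>r. a * r * (b - a) = 0)"
    by (simp only: central_cover_annihilator central_cover_star)
  ultimately show ?thesis
    by (simp only: eq_central_cover_mult_iff)
qed

end
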